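(* Let $F$ be a finite field of characteristic two and $G$ a finite $2$-group. Let $c\in \zeta(G)[2]\setminus G_P$, let $C=\langle c\rangle$ and $\overline{G}=G/C$. If $\overline{G}\in\Theta$, then \[ |V_*(FG)|=|F|^{\frac{|G|+|G_T|}{4}}\cdot |V_*(F\overline{G})|. \]
   Context: For a finite $2$-group $G$ and a finite field $F$ of characteristic two, $FG$ is the group algebra, and $*$ is the classical involution of $FG$, i.e. the $F$-linear extension of $g\mapsto g^{-1}$ ($g\in G$). $V(FG)$ is the group of normalized units of $FG$ (units whose coefficients sum to $1$). $V_*(FG)=\{u\in V(FG) : u^*=u^{-1}\}$ is the $*$-unitary subgroup. $\zeta(G)$ is the center of $G$, and $\zeta(G)[2]$ is the subgroup of $\zeta(G)$ generated by its elements of order $2$. $G_T=\{g\in G : g^2=1\}$ (so $1\in G_T$), and $G_P=\{g^2 : g\in G\}$. $\Theta$ is the class of all groups $K$ such that for all $g\in K\setminus K_T$ and all $h\in K$ one has $h^{-1}gh=g$ or $h^{-1}gh=g^{-1}$, where $K_T=\{g\in K: g^2=1\}$. *)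

theory Defs
  imports Complex_Main "HOL-Algebra.Algebra"
begin

definition ring_characteristic :: "('f, 'n) ring_scheme \<Rightarrow> nat" where
  "ring_characteristic R =
     (if \<exists>n::nat. 0 < n \<and> [n] \<cdot>\<^bsub>R\<^esub> \<one>\<^bsub>R\<^esub> = \<zero>\<^bsub>R\<^esub>
      then LEAST n::nat. 0 < n \<and> [n] \<cdot>\<^bsub>R\<^esub> \<one>\<^bsub>R\<^esub> = \<zero>\<^bsub>R\<^esub>
      else 0)"

definition finite_p_group :: "nat \<Rightarrow> ('g, 'm) monoid_scheme \<Rightarrow> bool" where
  "finite_p_group p G \<longleftrightarrow> group G \<and> finite (carrier G) \<and> (\<exists>n::nat. order G = p ^ n)"

definition group_center :: "('g, 'm) monoid_scheme \<Rightarrow> 'g set" where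
  "group_center G = {z \<in> carrier G. \<forall>g\<in>carrier G. z \<otimes>\<^bsub>G\<^esub> g = g \<otimes>\<^bsub>G\<^esub> z}"

definition center_2 :: "('g, 'm) monoid_scheme \<Rightarrow> 'g set" where
  "center_2 G = generate G {z \<in> group_center G. group.ord G z = 2}"

definition square_trivial :: "('g, 'm) monoid_scheme \<Rightarrow> 'g set" where
  "square_trivial G = {g \<in> carrier G. g [^]\<^bsub>G\<^esub> (2::nat) = \<one>\<^bsub>G\<^esub>}"

definition squares :: "('g, 'm) monoid_scheme \<Rightarrow> 'g set" where
  "squares G = {g [^]\<^bsub>G\<^esub> (2::nat) | g. g \<in> carrier G}"

definition in_Theta :: "('g, 'm) monoid_scheme \<Rightarrow> bool" where
  "in_Theta K \<longleftrightarrow> group K \<and>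
     (\<forall>g \<in> carrier K - square_trivial K. \<forall>h \<in> carrier K.
        inv\<^bsub>K\<^esub> h \<otimes>\<^bsub>K\<^esub> g \<otimes>\<^bsub>K\<^esub> h = g \<or> inv\<^bsub>K\<^esub> h \<otimes>\<^bsub>K\<^esub> g \<otimes>\<^bsub>K\<^esub> h = inv\<^bsub>K\<^esub> g)"

text \<open>
  For a finite group \<open>G\<close>, the element \<open>\<Sum> a(g) g\<close> of the group algebra \<open>FG\<close> is represented by its
  coefficient function \<open>a\<close>, made extensional outside the carrier of \<open>G\<close>; multiplication is
  convolution. Finiteness of \<open>G\<close> is essential: no finite-support condition is imposed.
\<close>

definition group_algebra ::
  "('f, 'n) ring_scheme \<Rightarrow> ('g, 'm) monoid_scheme \<Rightarrow> ('g \<Rightarrow> 'f) ring" where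
  "group_algebra F G =
     \<lparr>carrier = carrier G \<rightarrow>\<^sub>E carrier F,
      monoid.mult = (\<lambda>a b. \<lambda>x\<in>carrier G.
                \<Oplus>\<^bsub>F\<^esub>y\<in>carrier G. a y \<otimes>\<^bsub>F\<^esub> b (inv\<^bsub>G\<^esub> y \<otimes>\<^bsub>G\<^esub> x)),
      monoid.one = (\<lambda>x\<in>carrier G. if x = \<one>\<^bsub>G\<^esub> then \<one>\<^bsub>F\<^esub> else \<zero>\<^bsub>F\<^esub>),
      ring.zero = (\<lambda>x\<in>carrier G. \<zero>\<^bsub>F\<^esub>),
      ring.add = (\<lambda>a b. \<lambda>x\<in>carrier G. a x \<oplus>\<^bsub>F\<^esub> b x)\<rparr>"

text \<open>
  The coefficient of \<open>x\<close> in \<open>\<Sum> a(g) g\<^sup>-\<^sup>1\<close> is \<open>a(x\<^sup>-\<^sup>1)\<close>.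
\<close>

definition classical_involution :: "('g, 'm) monoid_scheme \<Rightarrow> ('g \<Rightarrow> 'f) \<Rightarrow> 'g \<Rightarrow> 'f" where
  "classical_involution G a = (\<lambda>x\<in>carrier G. a (inv\<^bsub>G\<^esub> x))"

definition normalized_units ::
  "('f, 'n) ring_scheme \<Rightarrow> ('g, 'm) monoid_scheme \<Rightarrow> ('g \<Rightarrow> 'f) set" where
  "normalized_units F G =
     {u \<in> Units (group_algebra F G). (\<Oplus>\<^bsub>F\<^esub>x\<in>carrier G. u x) = \<one>\<^bsub>F\<^esub>}"

definition unitary_subgroup ::
  "('f, 'n) ring_scheme \<Rightarrow> ('g, 'm) monoid_scheme \<Rightarrow> ('g \<Rightarrow> 'f) set" where
  "unitary_subgroup F G =
     {u \<in> normalized_units F G. classical_involution G u = inv\<^bsub>group_algebra F G\<^esub> u}"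

end

theory Submission
  imports Defs
begin

text \<open>
  Let \<open>h\<close> be the quotient map from \<open>G\<close> and \<open>K = (1 + c) FG\<close> the kernel of the induced map on group
  algebras, so that \<open>K K = 0\<close>. The unitary units mapping to \<open>1\<close> are the \<open>1 + s\<close> with \<open>s \<in> K\<close> and
  \<open>s* = s\<close>, that is, the functions constant on the orbits \<open>{x, cx, x\<^sup>-\<^sup>1, cx\<^sup>-\<^sup>1}\<close>; as \<open>c\<close> is not a
  square, an orbit has two elements when \<open>x\<^sup>2 = 1\<close> and four otherwise. A unitary unit of the quotient
  lifts: for any preimage \<open>u\<close>, the element \<open>z = u u* + 1\<close> is a symmetric element of \<open>K\<close>. Its
  coefficient at an involution \<open>g\<close> vanishes because the terms \<open>u(y) u(gy)\<close> cancel in pairs \<open>y, gy\<close>,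
  and its coefficient at \<open>1\<close> equals the one at \<open>c\<close>. Hence \<open>z = j + j*\<close> with \<open>j \<in> K\<close>, and
  \<open>(1 + j) u\<close> is unitary.
\<close>

section \<open>Rearranging finite sums\<close>

lemma (in abelian_monoid) finsum_swap:
  assumes "finite A" "finite B" "\<And>a b. a \<in> A \<Longrightarrow> b \<in> B \<Longrightarrow> f a b \<in> carrier G"
  shows "(\<Oplus>a\<in>A. \<Oplus>b\<in>B. f a b) = (\<Oplus>b\<in>B. \<Oplus>a\<in>A. f a b)"
  using assms
proof (induction A rule: finite_induct)
  case empty
  then show ?case by simp
next
  case (insert x A)
  have "(\<Oplus>a\<in>insert x A. \<Oplus>b\<in>B. f a b) = (\<Oplus>b\<in>B. f x b) \<oplus> (\<Oplus>a\<in>A. \<Oplus>b\<in>B. f a b)"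
    using insert by (intro finsum_insert) (auto intro!: finsum_closed)
  also have "\<dots> = (\<Oplus>b\<in>B. f x b) \<oplus> (\<Oplus>b\<in>B. \<Oplus>a\<in>A. f a b)"
    using insert by simp
  also have "\<dots> = (\<Oplus>b\<in>B. f x b \<oplus> (\<Oplus>a\<in>A. f a b))"
    using insert by (intro finsum_addf[symmetric]) (auto intro!: finsum_closed)
  also have "\<dots> = (\<Oplus>b\<in>B. \<Oplus>a\<in>insert x A. f a b)"
    using insert by (intro finsum_cong') (auto intro!: finsum_closed simp: Pi_iff)
  finally show ?case .
qed

lemma (in abelian_monoid) finsum_fibres:
  assumes "finite A" "finite B" "h \<in> A \<rightarrow> B" "f \<in> A \<rightarrow> carrier G"
  shows "(\<Oplus>b\<in>B. \<Oplus>a\<in>{a \<in> A. h a = b}. f a) = (\<Oplus>a\<in>A. f a)"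
proof -
  have "(\<Union>b\<in>B. {a \<in> A. h a = b}) = A"
    using assms(3) by auto
  moreover have "(\<Oplus>a\<in>(\<Union>b\<in>B. {a \<in> A. h a = b}). f a) = (\<Oplus>b\<in>B. \<Oplus>a\<in>{a \<in> A. h a = b}. f a)"
    using assms by (intro add.finprod_UN_disjoint) (auto simp: pairwise_def disjnt_def)
  ultimately show ?thesis by simp
qed

lemma (in abelian_monoid) finsum_bij_betw:
  assumes "bij_betw h A B" "f \<in> B \<rightarrow> carrier G"
  shows "(\<Oplus>b\<in>B. f b) = (\<Oplus>a\<in>A. f (h a))"
  using finsum_reindex[of f h A] assms unfolding bij_betw_def by auto

text \<open>A fixed-point-free involution \<open>t\<close> cuts \<open>A\<close> into cells
  \<open>{a, t a}\<close>, and each cell contributes zero. In characteristic two the last hypothesis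
  follows from \<open>f (t a) = f a\<close>, which is how both later applications obtain it.\<close>

lemma (in abelian_monoid) finsum_involution_cancel:
  assumes fin: "finite A" and f: "f \<in> A \<rightarrow> carrier G"
    and t: "t \<in> A \<rightarrow> A" "\<And>a. a \<in> A \<Longrightarrow> t (t a) = a" "\<And>a. a \<in> A \<Longrightarrow> t a \<noteq> a"
    and ft: "\<And>a. a \<in> A \<Longrightarrow> f a \<oplus> f (t a) = \<zero>"
  shows "(\<Oplus>a\<in>A. f a) = \<zero>"
proof -
  let ?C = "(\<lambda>a. {a, t a}) ` A"
  have "\<Union>?C = A" using t(1) by auto
  moreover have "finsum G f (\<Union>?C) = finsum G (finsum G f) ?C"
  proof (rule add.finprod_Union_disjoint)
    show "pairwise disjnt ?C"
    unfolding pairwise_def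
    proof (intro ballI impI)
      fix P Q assume "P \<in> ?C" "Q \<in> ?C" and ne: "P \<noteq> Q"
      then obtain x y where xy: "x \<in> A" "y \<in> A" and PQ: "P = {x, t x}" "Q = {y, t y}"
        by blast
      \<comment> \<open>Applying \<open>t\<close> to any coincidence between the two cells matches
        their other elements as well, so cells that meet are equal.\<close>
      have "{x, t x} = {y, t y}" if "x = y \<or> x = t y \<or> t x = y \<or> t x = t y"
        using that t(2)[OF xy(1)] t(2)[OF xy(2)] by (metis insert_commute)
      then show "disjnt P Q"
        using ne unfolding PQ disjnt_def by blast
    qed
  qed (use fin f t(1) in auto)
  moreover have "finsum G f P = \<zero>" if "P \<in> ?C" for P
  proof -
    from that obtain a where a: "a \<in> A" "P = {a, t a}" by auto
    moreover have "t a \<noteq> a" "t a \<in> A" using a t by auto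
    ultimately have "finsum G f P = f a \<oplus> f (t a)"
      using f by (simp add: Pi_iff)
    then show ?thesis using ft a by simp
  qed
  then have "finsum G (finsum G f) ?C = \<zero>"
    by (rule add.finprod_one_eqI)
  ultimately show ?thesis by simp
qed

section \<open>The group algebra as a ring with involution\<close>

locale finite_group_ring = F: cring F + G: group G
  for F :: "('f, 'n) ring_scheme" (structure) and G :: "('g, 'm) monoid_scheme" +
  assumes finite_carrier: "finite (carrier G)"
begin

abbreviation FG where "FG \<equiv> group_algebra F G"
abbreviation star where "star \<equiv> classical_involution G"

lemma FG_carrier: "carrier FG = carrier G \<rightarrow>\<^sub>E carrier F"
  by (simp add: group_algebra_def)

lemma FG_apply [simp]:
  "a \<in> carrier FG \<Longrightarrow> x \<in> carrier G \<Longrightarrow> a x \<in> carrier F"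
  by (auto simp: FG_carrier)

lemma FG_eqI:
  "a \<in> carrier FG \<Longrightarrow> b \<in> carrier FG \<Longrightarrow> (\<And>x. x \<in> carrier G \<Longrightarrow> a x = b x) \<Longrightarrow> a = b"
  unfolding FG_carrier by (rule PiE_ext)

lemma FG_mult_apply:
  "x \<in> carrier G \<Longrightarrow>
    (a \<otimes>\<^bsub>FG\<^esub> b) x = (\<Oplus>y\<in>carrier G. a y \<otimes> b (inv\<^bsub>G\<^esub> y \<otimes>\<^bsub>G\<^esub> x))"
  by (simp add: group_algebra_def)

lemma FG_add_apply [simp]: "x \<in> carrier G \<Longrightarrow> (a \<oplus>\<^bsub>FG\<^esub> b) x = a x \<oplus> b x"
  by (simp add: group_algebra_def)

lemma FG_one_apply [simp]: "x \<in> carrier G \<Longrightarrow> \<one>\<^bsub>FG\<^esub> x = (if x = \<one>\<^bsub>G\<^esub> then \<one> else \<zero>)"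
  by (simp add: group_algebra_def)

lemma FG_zero_apply [simp]: "x \<in> carrier G \<Longrightarrow> \<zero>\<^bsub>FG\<^esub> x = \<zero>"
  by (simp add: group_algebra_def)

lemma star_apply [simp]: "x \<in> carrier G \<Longrightarrow> star a x = a (inv\<^bsub>G\<^esub> x)"
  by (simp add: classical_involution_def)

lemma FG_mult_closed: "a \<in> carrier FG \<Longrightarrow> b \<in> carrier FG \<Longrightarrow> a \<otimes>\<^bsub>FG\<^esub> b \<in> carrier FG"
  unfolding FG_carrier by (auto simp: group_algebra_def intro!: F.finsum_closed)

lemma FG_closed:
  "\<one>\<^bsub>FG\<^esub> \<in> carrier FG" "\<zero>\<^bsub>FG\<^esub> \<in> carrier FG"
  "a \<in> carrier FG \<Longrightarrow> b \<in> carrier FG \<Longrightarrow> a \<oplus>\<^bsub>FG\<^esub> b \<in> carrier FG"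
  by (auto simp: group_algebra_def)

lemma star_closed [simp]: "a \<in> carrier FG \<Longrightarrow> star a \<in> carrier FG"
  by (auto simp: FG_carrier classical_involution_def)

lemma bij_left_mult: "g \<in> carrier G \<Longrightarrow> bij_betw (\<lambda>x. g \<otimes>\<^bsub>G\<^esub> x) (carrier G) (carrier G)"
  by (rule bij_betw_byWitness[where f' = "\<lambda>x. inv\<^bsub>G\<^esub> g \<otimes>\<^bsub>G\<^esub> x"])
     (auto simp: G.m_assoc[symmetric])

lemma bij_inv: "bij_betw (\<lambda>x. inv\<^bsub>G\<^esub> x) (carrier G) (carrier G)"
  by (rule bij_betw_byWitness[where f' = "\<lambda>x. inv\<^bsub>G\<^esub> x"]) auto

text \<open>Both sides are the same double sum: after exchanging the order of summation, the
  substitution z = y w turns the inner sum into a convolution of \<open>b\<close> and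
  \<open>d\<close>.\<close>

lemma FG_mult_assoc:
  assumes [simp]: "a \<in> carrier FG" "b \<in> carrier FG" "d \<in> carrier FG"
  shows "a \<otimes>\<^bsub>FG\<^esub> b \<otimes>\<^bsub>FG\<^esub> d = a \<otimes>\<^bsub>FG\<^esub> (b \<otimes>\<^bsub>FG\<^esub> d)"
proof (rule FG_eqI)
  note [simp] = finite_carrier
  fix x assume x [simp]: "x \<in> carrier G"
  have "(a \<otimes>\<^bsub>FG\<^esub> b \<otimes>\<^bsub>FG\<^esub> d) x =
      (\<Oplus>z\<in>carrier G. \<Oplus>y\<in>carrier G.
        a y \<otimes> b (inv\<^bsub>G\<^esub> y \<otimes>\<^bsub>G\<^esub> z) \<otimes> d (inv\<^bsub>G\<^esub> z \<otimes>\<^bsub>G\<^esub> x))"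
    unfolding FG_mult_apply[OF x]
    by (intro F.finsum_cong') (auto simp: FG_mult_apply F.finsum_ldistr intro!: F.finsum_closed)
  also have "\<dots> = (\<Oplus>y\<in>carrier G. \<Oplus>z\<in>carrier G.
        a y \<otimes> b (inv\<^bsub>G\<^esub> y \<otimes>\<^bsub>G\<^esub> z) \<otimes> d (inv\<^bsub>G\<^esub> z \<otimes>\<^bsub>G\<^esub> x))"
    by (rule F.finsum_swap) auto
  also have "\<dots> = (\<Oplus>y\<in>carrier G. a y \<otimes> (b \<otimes>\<^bsub>FG\<^esub> d) (inv\<^bsub>G\<^esub> y \<otimes>\<^bsub>G\<^esub> x))"
  proof (intro F.finsum_cong' refl)
    fix y assume y [simp]: "y \<in> carrier G"
    have "(\<Oplus>z\<in>carrier G. a y \<otimes> b (inv\<^bsub>G\<^esub> y \<otimes>\<^bsub>G\<^esub> z) \<otimes> d (inv\<^bsub>G\<^esub> z \<otimes>\<^bsub>G\<^esub> x)) =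
      (\<Oplus>w\<in>carrier G. a y \<otimes> (b w \<otimes> d (inv\<^bsub>G\<^esub> w \<otimes>\<^bsub>G\<^esub> (inv\<^bsub>G\<^esub> y \<otimes>\<^bsub>G\<^esub> x))))"
      by (subst F.finsum_bij_betw[OF bij_left_mult[OF y]])
         (auto intro!: F.finsum_cong' simp: G.m_assoc[symmetric] G.inv_mult_group F.m_assoc)
    also have "\<dots> = a y \<otimes> (b \<otimes>\<^bsub>FG\<^esub> d) (inv\<^bsub>G\<^esub> y \<otimes>\<^bsub>G\<^esub> x)"
      by (simp add: FG_mult_apply F.finsum_rdistr)
    finally show "(\<Oplus>z\<in>carrier G. a y \<otimes> b (inv\<^bsub>G\<^esub> y \<otimes>\<^bsub>G\<^esub> z) \<otimes> d (inv\<^bsub>G\<^esub> z \<otimes>\<^bsub>G\<^esub> x)) =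
      a y \<otimes> (b \<otimes>\<^bsub>FG\<^esub> d) (inv\<^bsub>G\<^esub> y \<otimes>\<^bsub>G\<^esub> x)" .
  qed (auto simp: FG_mult_closed)
  finally show "(a \<otimes>\<^bsub>FG\<^esub> b \<otimes>\<^bsub>FG\<^esub> d) x = (a \<otimes>\<^bsub>FG\<^esub> (b \<otimes>\<^bsub>FG\<^esub> d)) x"
    by (simp add: FG_mult_apply)
qed (simp_all add: FG_mult_closed)

lemma FG_l_one:
  assumes [simp]: "a \<in> carrier FG"
  shows "\<one>\<^bsub>FG\<^esub> \<otimes>\<^bsub>FG\<^esub> a = a"
proof (rule FG_eqI)
  fix x assume x [simp]: "x \<in> carrier G"
  have "(\<one>\<^bsub>FG\<^esub> \<otimes>\<^bsub>FG\<^esub> a) x =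
     (\<Oplus>y\<in>carrier G. if \<one>\<^bsub>G\<^esub> = y then a (inv\<^bsub>G\<^esub> y \<otimes>\<^bsub>G\<^esub> x) else \<zero>)"
    unfolding FG_mult_apply[OF x] by (intro F.finsum_cong') auto
  also have "\<dots> = a x"
    by (subst F.finsum_singleton) (auto simp: finite_carrier)
  finally show "(\<one>\<^bsub>FG\<^esub> \<otimes>\<^bsub>FG\<^esub> a) x = a x" .
qed (simp_all add: FG_mult_closed FG_closed)

lemma star_one [simp]: "star \<one>\<^bsub>FG\<^esub> = \<one>\<^bsub>FG\<^esub>"
  by (rule FG_eqI) (auto simp: FG_closed)

lemma star_star [simp]: "a \<in> carrier FG \<Longrightarrow> star (star a) = a"
  by (rule FG_eqI) auto

lemma star_add:
  "a \<in> carrier FG \<Longrightarrow> b \<in> carrier FG \<Longrightarrow> star (a \<oplus>\<^bsub>FG\<^esub> b) = star a \<oplus>\<^bsub>FG\<^esub> star b"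
  by (rule FG_eqI) (auto simp: FG_closed)

lemma star_mult:
  assumes [simp]: "a \<in> carrier FG" "b \<in> carrier FG"
  shows "star (a \<otimes>\<^bsub>FG\<^esub> b) = star b \<otimes>\<^bsub>FG\<^esub> star a"
proof (rule FG_eqI)
  fix x assume x [simp]: "x \<in> carrier G"
  have "star (a \<otimes>\<^bsub>FG\<^esub> b) x = (\<Oplus>y\<in>carrier G. a y \<otimes> b (inv\<^bsub>G\<^esub> y \<otimes>\<^bsub>G\<^esub> inv\<^bsub>G\<^esub> x))"
    by (simp add: FG_mult_apply)
  \<comment> \<open>The substitution y -> x^-1 y moves the translation from \<open>b\<close> to
    \<open>a\<close>. Commutativity of \<open>F\<close> then puts the factors in the reversed
    order.\<close>
  also have "\<dots> = (\<Oplus>y\<in>carrier G. a (inv\<^bsub>G\<^esub> x \<otimes>\<^bsub>G\<^esub> y) \<otimes> b (inv\<^bsub>G\<^esub> y))"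
    by (subst F.finsum_bij_betw[OF bij_left_mult[of "inv\<^bsub>G\<^esub> x"]])
       (auto intro!: F.finsum_cong' simp: G.inv_mult_group G.m_assoc)
  also have "\<dots> = (star b \<otimes>\<^bsub>FG\<^esub> star a) x"
    by (auto intro!: F.finsum_cong' simp: FG_mult_apply G.inv_mult_group F.m_comm)
  finally show "star (a \<otimes>\<^bsub>FG\<^esub> b) x = (star b \<otimes>\<^bsub>FG\<^esub> star a) x" .
qed (simp_all add: FG_mult_closed)

text \<open>The involution reverses products and fixes \<open>1\<close>, so it carries the left unit
  law to the right one.\<close>

lemma FG_r_one:
  assumes "a \<in> carrier FG"
  shows "a \<otimes>\<^bsub>FG\<^esub> \<one>\<^bsub>FG\<^esub> = a"
proof -
  have "star (star (a \<otimes>\<^bsub>FG\<^esub> \<one>\<^bsub>FG\<^esub>)) = a"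
    using assms by (simp add: star_mult FG_l_one FG_closed)
  then show ?thesis using assms by (simp add: FG_mult_closed FG_closed)
qed

lemma FG_l_distr:
  assumes [simp]: "a \<in> carrier FG" "b \<in> carrier FG" "d \<in> carrier FG"
  shows "(a \<oplus>\<^bsub>FG\<^esub> b) \<otimes>\<^bsub>FG\<^esub> d = a \<otimes>\<^bsub>FG\<^esub> d \<oplus>\<^bsub>FG\<^esub> b \<otimes>\<^bsub>FG\<^esub> d"
proof (rule FG_eqI)
  fix x assume x [simp]: "x \<in> carrier G"
  show "((a \<oplus>\<^bsub>FG\<^esub> b) \<otimes>\<^bsub>FG\<^esub> d) x = (a \<otimes>\<^bsub>FG\<^esub> d \<oplus>\<^bsub>FG\<^esub> b \<otimes>\<^bsub>FG\<^esub> d) x"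
    unfolding FG_add_apply[OF x] FG_mult_apply[OF x]
    by (subst F.finsum_addf[symmetric]) (auto intro!: F.finsum_cong' simp: F.l_distr
        simp del: F.finsum_addf)
qed (simp_all add: FG_mult_closed FG_closed)

lemma FG_r_distr:
  assumes [simp]: "a \<in> carrier FG" "b \<in> carrier FG" "d \<in> carrier FG"
  shows "d \<otimes>\<^bsub>FG\<^esub> (a \<oplus>\<^bsub>FG\<^esub> b) = d \<otimes>\<^bsub>FG\<^esub> a \<oplus>\<^bsub>FG\<^esub> d \<otimes>\<^bsub>FG\<^esub> b"
proof (rule FG_eqI)
  fix x assume x [simp]: "x \<in> carrier G"
  show "(d \<otimes>\<^bsub>FG\<^esub> (a \<oplus>\<^bsub>FG\<^esub> b)) x = (d \<otimes>\<^bsub>FG\<^esub> a \<oplus>\<^bsub>FG\<^esub> d \<otimes>\<^bsub>FG\<^esub> b) x"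
    unfolding FG_add_apply[OF x] FG_mult_apply[OF x]
    by (subst F.finsum_addf[symmetric]) (auto intro!: F.finsum_cong' simp: F.r_distr
        simp del: F.finsum_addf)
qed (simp_all add: FG_mult_closed FG_closed)

lemma FG_l_neg:
  assumes "a \<in> carrier FG"
  shows "\<exists>b\<in>carrier FG. b \<oplus>\<^bsub>FG\<^esub> a = \<zero>\<^bsub>FG\<^esub>"
proof
  let ?b = "\<lambda>x\<in>carrier G. \<ominus> a x"
  show b: "?b \<in> carrier FG" using assms by (auto simp: FG_carrier)
  show "?b \<oplus>\<^bsub>FG\<^esub> a = \<zero>\<^bsub>FG\<^esub>"
    using assms b by (intro FG_eqI) (auto simp: FG_closed F.l_neg)
qed

lemma FG_ring: "ring FG"
proof (rule ringI)
  show "abelian_group FG"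
  proof (rule abelian_groupI)
    fix x y z assume "x \<in> carrier FG" "y \<in> carrier FG" "z \<in> carrier FG"
    then show "x \<oplus>\<^bsub>FG\<^esub> y \<oplus>\<^bsub>FG\<^esub> z = x \<oplus>\<^bsub>FG\<^esub> (y \<oplus>\<^bsub>FG\<^esub> z)"
      by (intro FG_eqI) (auto simp: FG_closed F.a_assoc)
  next
    fix x y assume "x \<in> carrier FG" "y \<in> carrier FG"
    then show "x \<oplus>\<^bsub>FG\<^esub> y = y \<oplus>\<^bsub>FG\<^esub> x"
      by (intro FG_eqI) (auto simp: FG_closed F.a_comm)
  next
    fix x assume "x \<in> carrier FG"
    then show "\<zero>\<^bsub>FG\<^esub> \<oplus>\<^bsub>FG\<^esub> x = x"
      by (intro FG_eqI) (auto simp: FG_closed)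
  qed (auto simp: FG_closed FG_l_neg)
  show "monoid FG"
    by (rule monoidI) (auto simp: FG_closed FG_mult_closed FG_mult_assoc FG_l_one FG_r_one)
qed (auto simp: FG_l_distr FG_r_distr)

sublocale FG: ring FG
  by (rule FG_ring)

section \<open>The augmentation homomorphism\<close>

definition aug where "aug a = (\<Oplus>x\<in>carrier G. a x)"

lemma aug_closed [simp]: "a \<in> carrier FG \<Longrightarrow> aug a \<in> carrier F"
  unfolding aug_def by (intro F.finsum_closed) auto

text \<open>For fixed y, left translation by y^-1 permutes the group, so each inner sum over x is
  \<open>a y\<close> times the full augmentation of \<open>b\<close>.\<close>

lemma aug_mult:
  assumes [simp]: "a \<in> carrier FG" "b \<in> carrier FG"
  shows "aug (a \<otimes>\<^bsub>FG\<^esub> b) = aug a \<otimes> aug b"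
proof -
  note [simp] = finite_carrier
  have "aug (a \<otimes>\<^bsub>FG\<^esub> b) =
      (\<Oplus>x\<in>carrier G. \<Oplus>y\<in>carrier G. a y \<otimes> b (inv\<^bsub>G\<^esub> y \<otimes>\<^bsub>G\<^esub> x))"
    unfolding aug_def
    by (intro F.finsum_cong') (auto simp: FG_mult_apply intro!: F.finsum_closed)
  also have "\<dots> = (\<Oplus>y\<in>carrier G. \<Oplus>x\<in>carrier G. a y \<otimes> b (inv\<^bsub>G\<^esub> y \<otimes>\<^bsub>G\<^esub> x))"
    by (rule F.finsum_swap) auto
  also have "\<dots> = (\<Oplus>y\<in>carrier G. a y \<otimes> aug b)"
  proof (intro F.finsum_cong' refl)
    fix y assume y [simp]: "y \<in> carrier G"
    have "(\<Oplus>x\<in>carrier G. a y \<otimes> b (inv\<^bsub>G\<^esub> y \<otimes>\<^bsub>G\<^esub> x)) =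
      a y \<otimes> (\<Oplus>x\<in>carrier G. b (inv\<^bsub>G\<^esub> y \<otimes>\<^bsub>G\<^esub> x))"
      by (subst F.finsum_rdistr) auto
    also have "(\<Oplus>x\<in>carrier G. b (inv\<^bsub>G\<^esub> y \<otimes>\<^bsub>G\<^esub> x)) = aug b"
      unfolding aug_def by (subst F.finsum_bij_betw[OF bij_left_mult[of "inv\<^bsub>G\<^esub> y"]]) auto
    finally show "(\<Oplus>x\<in>carrier G. a y \<otimes> b (inv\<^bsub>G\<^esub> y \<otimes>\<^bsub>G\<^esub> x)) = a y \<otimes> aug b" .
  qed auto
  also have "\<dots> = aug a \<otimes> aug b"
    unfolding aug_def[of a] by (subst F.finsum_ldistr) auto
  finally show ?thesis .
qed

lemma aug_one [simp]: "aug \<one>\<^bsub>FG\<^esub> = \<one>"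
proof -
  have "aug \<one>\<^bsub>FG\<^esub> = (\<Oplus>x\<in>carrier G. if \<one>\<^bsub>G\<^esub> = x then \<one> else \<zero>)"
    unfolding aug_def by (intro F.finsum_cong') auto
  then show ?thesis
    using finite_carrier by (simp add: F.finsum_singleton)
qed

lemma aug_star [simp]: "a \<in> carrier FG \<Longrightarrow> aug (star a) = aug a"
  unfolding aug_def by (subst F.finsum_bij_betw[OF bij_inv]) (auto intro!: F.finsum_cong')

end

section \<open>Unitary units over a finite field of characteristic two\<close>

locale char2_group_ring = finite_group_ring F G + F: field F
  for F :: "('f, 'n) ring_scheme" (structure) and G :: "('g, 'm) monoid_scheme" +
  assumes finite_F: "finite (carrier F)" and two_eq_zero: "\<one> \<oplus> \<one> = \<zero>"
begin

lemma add_self: "x \<in> carrier F \<Longrightarrow> x \<oplus> x = \<zero>"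
  using F.l_distr[of \<one> \<one> x] two_eq_zero by simp

lemma FG_add_self: "a \<in> carrier FG \<Longrightarrow> a \<oplus>\<^bsub>FG\<^esub> a = \<zero>\<^bsub>FG\<^esub>"
  by (rule FG_eqI) (auto simp: add_self)

lemma FG_eq_iff_add_zero:
  assumes "a \<in> carrier FG" "b \<in> carrier FG"
  shows "a \<oplus>\<^bsub>FG\<^esub> b = \<zero>\<^bsub>FG\<^esub> \<longleftrightarrow> a = b"
  using assms FG_add_self FG.minus_equality by metis

lemma finite_FG: "finite (carrier FG)"
  unfolding FG_carrier by (intro finite_PiE finite_carrier finite_F)

text \<open>Right multiplication by \<open>a\<close> is injective because multiplying by
  \<open>b\<close> undoes it. The algebra is finite, so this map is onto and \<open>1\<close> is
  hit; the resulting left inverse must agree with \<open>b\<close>.\<close>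

lemma right_inverse_is_left_inverse:
  assumes [simp]: "a \<in> carrier FG" "b \<in> carrier FG" and ab: "a \<otimes>\<^bsub>FG\<^esub> b = \<one>\<^bsub>FG\<^esub>"
  shows "b \<otimes>\<^bsub>FG\<^esub> a = \<one>\<^bsub>FG\<^esub>"
proof -
  have "inj_on (\<lambda>x. x \<otimes>\<^bsub>FG\<^esub> a) (carrier FG)"
  proof (rule inj_onI)
    fix x y assume "x \<in> carrier FG" "y \<in> carrier FG" "x \<otimes>\<^bsub>FG\<^esub> a = y \<otimes>\<^bsub>FG\<^esub> a"
    then show "x = y"
      using ab by (metis FG.m_assoc FG.r_one assms(1,2))
  qed
  moreover have "(\<lambda>x. x \<otimes>\<^bsub>FG\<^esub> a) ` carrier FG \<subseteq> carrier FG"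
    by auto
  ultimately have "(\<lambda>x. x \<otimes>\<^bsub>FG\<^esub> a) ` carrier FG = carrier FG"
    using finite_FG endo_inj_surj by blast
  then obtain d where d: "d \<in> carrier FG" "d \<otimes>\<^bsub>FG\<^esub> a = \<one>\<^bsub>FG\<^esub>"
    by (metis (no_types, lifting) FG.one_closed imageE)
  then have "d = b"
    using ab by (metis FG.inv_unique assms(1,2))
  then show ?thesis using d by simp
qed

text \<open>Invertibility and normalization both come for free from the one equation: finiteness
  makes \<open>star a\<close> a two-sided inverse, and the involution preserves the augmentation,
  whose square is therefore \<open>1\<close>. All later arguments use this description.\<close>

lemma unitary_subgroup_eq:
  "unitary_subgroup F G = {a \<in> carrier FG. a \<otimes>\<^bsub>FG\<^esub> star a = \<one>\<^bsub>FG\<^esub>}"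
proof (intro equalityI subsetI)
  fix a assume "a \<in> unitary_subgroup F G"
  then have a: "a \<in> Units FG" "star a = inv\<^bsub>FG\<^esub> a"
    by (auto simp: unitary_subgroup_def normalized_units_def)
  then show "a \<in> {a \<in> carrier FG. a \<otimes>\<^bsub>FG\<^esub> star a = \<one>\<^bsub>FG\<^esub>}"
    using FG.Units_r_inv by auto
next
  fix a assume "a \<in> {a \<in> carrier FG. a \<otimes>\<^bsub>FG\<^esub> star a = \<one>\<^bsub>FG\<^esub>}"
  then have a [simp]: "a \<in> carrier FG" and r: "a \<otimes>\<^bsub>FG\<^esub> star a = \<one>\<^bsub>FG\<^esub>" by auto
  have l: "star a \<otimes>\<^bsub>FG\<^esub> a = \<one>\<^bsub>FG\<^esub>"
    by (rule right_inverse_is_left_inverse[OF _ _ r]) auto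
  have "a \<in> Units FG" using l r unfolding Units_def by (auto intro!: bexI[of _ "star a"])
  moreover have "star a = inv\<^bsub>FG\<^esub> a"
    using l r by (metis FG.inv_char a star_closed)
  moreover have "aug a = \<one>"
  proof -
    have sq: "aug a \<otimes> aug a = \<one>"
      using arg_cong[OF r, of aug] by (simp add: aug_mult)
    \<comment> \<open>In characteristic two a square root of \<open>1\<close> in a field is
      \<open>1\<close>, because its sum with \<open>1\<close> squares to zero.\<close>
    have "(aug a \<oplus> \<one>) \<otimes> (aug a \<oplus> \<one>) = (aug a \<otimes> aug a \<oplus> \<one>) \<oplus> (aug a \<oplus> aug a)"
      by (simp add: F.l_distr F.r_distr F.a_ac)
    also have "\<dots> = \<zero>" using sq by (simp add: add_self)
    finally have "aug a \<oplus> \<one> = \<zero>"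
      using F.integral[of "aug a \<oplus> \<one>" "aug a \<oplus> \<one>"] by simp
    then show ?thesis
      using two_eq_zero by (metis F.add.inv_equality F.one_closed a aug_closed)
  qed
  ultimately show "a \<in> unitary_subgroup F G"
    by (auto simp: unitary_subgroup_def normalized_units_def aug_def)
qed

text \<open>The coefficient is the sum of the products of \<open>a y\<close> and
  \<open>a (g y)\<close>. The map y -> g y has no fixed points and only swaps the two factors, so
  equal terms cancel in pairs.\<close>

lemma norm_coeff_involution:
  assumes [simp]: "a \<in> carrier FG" "g \<in> carrier G" and g: "g \<otimes>\<^bsub>G\<^esub> g = \<one>\<^bsub>G\<^esub>" "g \<noteq> \<one>\<^bsub>G\<^esub>"
  shows "(a \<otimes>\<^bsub>FG\<^esub> star a) g = \<zero>"
proof -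
  have gg: "g \<otimes>\<^bsub>G\<^esub> (g \<otimes>\<^bsub>G\<^esub> y) = y" if "y \<in> carrier G" for y
    using that g(1) by (simp add: G.m_assoc[symmetric])
  have "(a \<otimes>\<^bsub>FG\<^esub> star a) g = (\<Oplus>y\<in>carrier G. a y \<otimes> a (g \<otimes>\<^bsub>G\<^esub> y))"
    using g(1) G.inv_equality[OF g(1)]
    by (auto intro!: F.finsum_cong' simp: FG_mult_apply G.inv_mult_group)
  also have "\<dots> = \<zero>"
    by (rule F.finsum_involution_cancel[where t = "\<lambda>y. g \<otimes>\<^bsub>G\<^esub> y"])
       (use g(2) in \<open>auto simp: gg finite_carrier add_self F.m_comm\<close>)
  finally show ?thesis .
qed

end

section \<open>The map of group algebras induced by a surjective homomorphism\<close>

locale group_ring_epi = A: finite_group_ring F G + B: finite_group_ring F H + group_hom G H h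
  for F :: "('f, 'n) ring_scheme" (structure) and G :: "('g, 'm) monoid_scheme"
    and H :: "('h, 'k) monoid_scheme" and h +
  assumes surj: "h ` carrier G = carrier H"
begin

text \<open>This is the \<open>F\<close>-linear extension of \<open>h\<close>, in terms of
  coefficient functions.\<close>

definition push :: "('g \<Rightarrow> 'f) \<Rightarrow> 'h \<Rightarrow> 'f" where
  "push a = (\<lambda>y\<in>carrier H. \<Oplus>x\<in>{x \<in> carrier G. h x = y}. a x)"

lemma push_apply: "y \<in> carrier H \<Longrightarrow> push a y = (\<Oplus>x\<in>{x \<in> carrier G. h x = y}. a x)"
  by (simp add: push_def)

lemma push_closed [simp]: "a \<in> carrier A.FG \<Longrightarrow> push a \<in> carrier B.FG"
  by (auto simp: push_def B.FG_carrier intro!: A.F.finsum_closed)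

lemma push_add:
  assumes [simp]: "a \<in> carrier A.FG" "b \<in> carrier A.FG"
  shows "push (a \<oplus>\<^bsub>A.FG\<^esub> b) = push a \<oplus>\<^bsub>B.FG\<^esub> push b"
proof (rule B.FG_eqI)
  fix y assume [simp]: "y \<in> carrier H"
  have "push (a \<oplus>\<^bsub>A.FG\<^esub> b) y = (\<Oplus>x\<in>{x \<in> carrier G. h x = y}. a x \<oplus> b x)"
    by (auto simp: push_apply intro!: A.F.finsum_cong' simp del: A.F.finsum_addf)
  also have "\<dots> = (push a \<oplus>\<^bsub>B.FG\<^esub> push b) y"
    by (subst A.F.finsum_addf) (auto simp: push_apply)
  finally show "push (a \<oplus>\<^bsub>A.FG\<^esub> b) y = (push a \<oplus>\<^bsub>B.FG\<^esub> push b) y" .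
qed auto

text \<open>Left translation by u^-1 carries the fibre over y bijectively onto the fibre over
  h(u)^-1 y.\<close>

lemma push_translate:
  assumes [simp]: "a \<in> carrier A.FG" "u \<in> carrier G" "y \<in> carrier H"
  shows "(\<Oplus>x\<in>{x \<in> carrier G. h x = y}. a (inv\<^bsub>G\<^esub> u \<otimes>\<^bsub>G\<^esub> x)) = push a (inv\<^bsub>H\<^esub> h u \<otimes>\<^bsub>H\<^esub> y)"
proof -
  have "bij_betw (\<lambda>x. inv\<^bsub>G\<^esub> u \<otimes>\<^bsub>G\<^esub> x) {x \<in> carrier G. h x = y}
      {x \<in> carrier G. h x = inv\<^bsub>H\<^esub> h u \<otimes>\<^bsub>H\<^esub> y}"
    by (rule bij_betw_byWitness[where f' = "\<lambda>x. u \<otimes>\<^bsub>G\<^esub> x"])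
       (auto simp: A.G.m_assoc[symmetric] B.G.m_assoc[symmetric])
  from A.F.finsum_bij_betw[OF this, of a] show ?thesis
    by (simp add: push_apply)
qed

lemma push_mult:
  assumes [simp]: "a \<in> carrier A.FG" "b \<in> carrier A.FG"
  shows "push (a \<otimes>\<^bsub>A.FG\<^esub> b) = push a \<otimes>\<^bsub>B.FG\<^esub> push b"
proof (rule B.FG_eqI)
  note [simp] = A.finite_carrier B.finite_carrier
  fix y assume y [simp]: "y \<in> carrier H"
  have "push (a \<otimes>\<^bsub>A.FG\<^esub> b) y = (\<Oplus>x\<in>{x \<in> carrier G. h x = y}. \<Oplus>u\<in>carrier G.
      a u \<otimes> b (inv\<^bsub>G\<^esub> u \<otimes>\<^bsub>G\<^esub> x))"
    unfolding push_apply[OF y]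
    by (intro A.F.finsum_cong') (auto simp: A.FG_mult_apply intro!: A.F.finsum_closed)
  also have "\<dots> = (\<Oplus>u\<in>carrier G. \<Oplus>x\<in>{x \<in> carrier G. h x = y}.
      a u \<otimes> b (inv\<^bsub>G\<^esub> u \<otimes>\<^bsub>G\<^esub> x))"
    by (rule A.F.finsum_swap) auto
  also have "\<dots> = (\<Oplus>u\<in>carrier G. a u \<otimes> push b (inv\<^bsub>H\<^esub> h u \<otimes>\<^bsub>H\<^esub> y))"
    by (intro A.F.finsum_cong')
       (auto simp: push_translate[symmetric] A.F.finsum_rdistr intro!: A.F.finsum_closed)
  \<comment> \<open>The second factor depends on u only through \<open>h u\<close>, so grouping the
    terms by \<open>z = h u\<close> lets it be pulled out of each fibre.\<close>
  also have "\<dots> = (\<Oplus>z\<in>carrier H. \<Oplus>u\<in>{u \<in> carrier G. h u = z}.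
      a u \<otimes> push b (inv\<^bsub>H\<^esub> h u \<otimes>\<^bsub>H\<^esub> y))"
    by (rule A.F.finsum_fibres[symmetric]) auto
  also have "\<dots> = (push a \<otimes>\<^bsub>B.FG\<^esub> push b) y"
  proof -
    have "(\<Oplus>u\<in>{u \<in> carrier G. h u = z}. a u \<otimes> push b (inv\<^bsub>H\<^esub> h u \<otimes>\<^bsub>H\<^esub> y)) =
        push a z \<otimes> push b (inv\<^bsub>H\<^esub> z \<otimes>\<^bsub>H\<^esub> y)" if [simp]: "z \<in> carrier H" for z
      by (auto simp: push_apply[of z] A.F.finsum_ldistr intro!: A.F.finsum_cong')
    then show ?thesis
      unfolding B.FG_mult_apply[OF y] by (auto intro!: A.F.finsum_cong')
  qed
  finally show "push (a \<otimes>\<^bsub>A.FG\<^esub> b) y = (push a \<otimes>\<^bsub>B.FG\<^esub> push b) y" .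
qed auto

lemma push_star:
  assumes [simp]: "a \<in> carrier A.FG"
  shows "push (A.star a) = B.star (push a)"
proof (rule B.FG_eqI)
  fix y assume [simp]: "y \<in> carrier H"
  have "bij_betw (\<lambda>x. inv\<^bsub>G\<^esub> x) {x \<in> carrier G. h x = y} {x \<in> carrier G. h x = inv\<^bsub>H\<^esub> y}"
    by (rule bij_betw_byWitness[where f' = "\<lambda>x. inv\<^bsub>G\<^esub> x"]) auto
  from A.F.finsum_bij_betw[OF this, of a]
  have "push a (inv\<^bsub>H\<^esub> y) = (\<Oplus>x\<in>{x \<in> carrier G. h x = y}. a (inv\<^bsub>G\<^esub> x))"
    by (simp add: push_apply)
  also have "\<dots> = push (A.star a) y"
    by (auto simp: push_apply intro!: A.F.finsum_cong')
  finally show "push (A.star a) y = B.star (push a) y" by simp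
qed auto

lemma push_surj:
  assumes b: "b \<in> carrier B.FG"
  obtains a where "a \<in> carrier A.FG" "push a = b"
proof -
  have "\<forall>y\<in>carrier H. \<exists>x. x \<in> carrier G \<and> h x = y"
    using surj by (metis (no_types, lifting) imageE)
  then obtain r where r: "\<And>y. y \<in> carrier H \<Longrightarrow> r y \<in> carrier G \<and> h (r y) = y"
    by metis
  \<comment> \<open>With \<open>r\<close> a section of \<open>h\<close>, each fibre carries its
    whole coefficient at the chosen point \<open>r y\<close> and zero elsewhere.\<close>
  let ?a = "\<lambda>x\<in>carrier G. if r (h x) = x then b (h x) else \<zero>"
  have a: "?a \<in> carrier A.FG" using b by (auto simp: A.FG_carrier)
  have "push ?a = b"
  proof (rule B.FG_eqI)
    fix y assume y: "y \<in> carrier H"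
    have "push ?a y = (\<Oplus>x\<in>{x \<in> carrier G. h x = y}. if r y = x then b y else \<zero>)"
      unfolding push_apply[OF y] using b y by (auto intro!: A.F.finsum_cong')
    also have "\<dots> = b y"
      using r[OF y] b y A.finite_carrier by (subst A.F.finsum_singleton) auto
    finally show "push ?a y = b y" .
  qed (use a b in auto)
  with a show ?thesis by (rule that)
qed

text \<open>Multiplicativity alone would only give an idempotent. Surjectivity provides a preimage
  \<open>a\<close> of \<open>1\<close>, and multiplying by its image identifies the two.\<close>

lemma push_one: "push \<one>\<^bsub>A.FG\<^esub> = \<one>\<^bsub>B.FG\<^esub>"
proof -
  obtain a where a: "a \<in> carrier A.FG" "push a = \<one>\<^bsub>B.FG\<^esub>"
    using push_surj[of "\<one>\<^bsub>B.FG\<^esub>"] by auto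
  then have "push \<one>\<^bsub>A.FG\<^esub> = push a \<otimes>\<^bsub>B.FG\<^esub> push \<one>\<^bsub>A.FG\<^esub>" by simp
  also have "\<dots> = push a" using a(1) by (simp add: push_mult[symmetric])
  finally show ?thesis using a by simp
qed

end

section \<open>Extensions with a kernel of order two generated by a non-square\<close>

locale char2_double_cover = A: char2_group_ring F G + B: char2_group_ring F H +
    group_ring_epi F G H h
  for F :: "('f, 'n) ring_scheme" (structure) and G :: "('g, 'm) monoid_scheme"
    and H :: "('h, 'k) monoid_scheme" and h +
  fixes c :: 'g
  assumes ker: "kernel G H h = {\<one>\<^bsub>G\<^esub>, c}" and c_ne: "c \<noteq> \<one>\<^bsub>G\<^esub>"
    and not_square: "c \<notin> squares G"
begin

lemma c_closed [simp]: "c \<in> carrier G" and h_c: "h c = \<one>\<^bsub>H\<^esub>"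
  using ker by (auto simp: kernel_def)

lemma kernelD: "x \<in> carrier G \<Longrightarrow> h x = \<one>\<^bsub>H\<^esub> \<Longrightarrow> x = \<one>\<^bsub>G\<^esub> \<or> x = c"
  using ker unfolding kernel_def by blast

text \<open>The square of \<open>c\<close> lies in the two-element kernel and cannot be
  \<open>c\<close> itself.\<close>

lemma c_square: "c \<otimes>\<^bsub>G\<^esub> c = \<one>\<^bsub>G\<^esub>"
proof -
  have "c \<otimes>\<^bsub>G\<^esub> c \<noteq> c" using c_ne by simp
  then show ?thesis using kernelD[of "c \<otimes>\<^bsub>G\<^esub> c"] by (auto simp: h_c)
qed

lemma inv_c [simp]: "inv\<^bsub>G\<^esub> c = c"
  using c_square by (simp add: A.G.inv_equality)

text \<open>A conjugate of \<open>c\<close> stays in the kernel; it is not the identity, so it is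
  \<open>c\<close>.\<close>

lemma c_central:
  assumes [simp]: "x \<in> carrier G"
  shows "x \<otimes>\<^bsub>G\<^esub> c = c \<otimes>\<^bsub>G\<^esub> x"
proof -
  have e: "x \<otimes>\<^bsub>G\<^esub> c \<otimes>\<^bsub>G\<^esub> inv\<^bsub>G\<^esub> x \<otimes>\<^bsub>G\<^esub> x = x \<otimes>\<^bsub>G\<^esub> c" by (simp add: A.G.m_assoc)
  have "x \<otimes>\<^bsub>G\<^esub> c \<otimes>\<^bsub>G\<^esub> inv\<^bsub>G\<^esub> x = \<one>\<^bsub>G\<^esub> \<or> x \<otimes>\<^bsub>G\<^esub> c \<otimes>\<^bsub>G\<^esub> inv\<^bsub>G\<^esub> x = c"
    by (rule kernelD) (auto simp: h_c)
  then show ?thesis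
  proof
    assume "x \<otimes>\<^bsub>G\<^esub> c \<otimes>\<^bsub>G\<^esub> inv\<^bsub>G\<^esub> x = \<one>\<^bsub>G\<^esub>"
    then have "x = x \<otimes>\<^bsub>G\<^esub> c" using e by simp
    then show ?thesis using c_ne by simp
  next
    assume "x \<otimes>\<^bsub>G\<^esub> c \<otimes>\<^bsub>G\<^esub> inv\<^bsub>G\<^esub> x = c"
    then show ?thesis using e by simp
  qed
qed

lemma c_cancel [simp]: "x \<in> carrier G \<Longrightarrow> c \<otimes>\<^bsub>G\<^esub> (c \<otimes>\<^bsub>G\<^esub> x) = x"
  by (simp add: A.G.m_assoc[symmetric] c_square)

lemma c_mult_ne [simp]: "x \<in> carrier G \<Longrightarrow> c \<otimes>\<^bsub>G\<^esub> x \<noteq> x"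
  using c_ne by simp

lemma inv_c_mult [simp]: "x \<in> carrier G \<Longrightarrow> inv\<^bsub>G\<^esub> (c \<otimes>\<^bsub>G\<^esub> x) = c \<otimes>\<^bsub>G\<^esub> inv\<^bsub>G\<^esub> x"
  by (simp add: A.G.inv_mult_group c_central)

lemma square_ne_c:
  assumes "x \<in> carrier G"
  shows "x \<otimes>\<^bsub>G\<^esub> x \<noteq> c"
proof -
  have "x [^]\<^bsub>G\<^esub> (2::nat) \<in> squares G"
    using assms unfolding squares_def by blast
  moreover have "x [^]\<^bsub>G\<^esub> (2::nat) = x \<otimes>\<^bsub>G\<^esub> x"
    using assms by (simp add: numeral_2_eq_2)
  ultimately show ?thesis using not_square by metis
qed

text \<open>Otherwise x^2 = c. This is the form in which the non-square hypothesis enters the orbit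
  count and the splitting of symmetric elements.\<close>

lemma ne_c_mult_inv: "x \<in> carrier G \<Longrightarrow> c \<otimes>\<^bsub>G\<^esub> inv\<^bsub>G\<^esub> x \<noteq> x"
  using square_ne_c[of x] A.G.inv_solve_right[of x c x] by auto

lemma h_eq_iff:
  assumes [simp]: "x \<in> carrier G" "y \<in> carrier G"
  shows "h y = h x \<longleftrightarrow> y = x \<or> y = c \<otimes>\<^bsub>G\<^esub> x"
proof
  assume "h y = h x"
  then have "y \<otimes>\<^bsub>G\<^esub> inv\<^bsub>G\<^esub> x = \<one>\<^bsub>G\<^esub> \<or> y \<otimes>\<^bsub>G\<^esub> inv\<^bsub>G\<^esub> x = c"
    by (intro kernelD) auto
  moreover have "y = y \<otimes>\<^bsub>G\<^esub> inv\<^bsub>G\<^esub> x \<otimes>\<^bsub>G\<^esub> x" by (simp add: A.G.m_assoc)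
  ultimately show "y = x \<or> y = c \<otimes>\<^bsub>G\<^esub> x"
    by (metis A.G.l_one assms(1))
qed (auto simp: h_c)

text \<open>The fibre through x is {x, cx}, and in characteristic two its two coefficients sum to
  zero exactly when they are equal.\<close>

lemma push_eq_zero_iff:
  assumes [simp]: "a \<in> carrier A.FG"
  shows "push a = \<zero>\<^bsub>B.FG\<^esub> \<longleftrightarrow> (\<forall>x\<in>carrier G. a (c \<otimes>\<^bsub>G\<^esub> x) = a x)"
proof -
  have p: "push a (h x) = a x \<oplus> a (c \<otimes>\<^bsub>G\<^esub> x)" if [simp]: "x \<in> carrier G" for x
  proof -
    have "{y \<in> carrier G. h y = h x} = {x, c \<otimes>\<^bsub>G\<^esub> x}"
      by (auto simp: h_eq_iff h_c)
    then show ?thesis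
      using c_mult_ne[of x, symmetric] by (simp add: push_apply)
  qed
  have "push a = \<zero>\<^bsub>B.FG\<^esub> \<longleftrightarrow> (\<forall>y\<in>carrier H. push a y = \<zero>)"
    using B.FG_eqI[of "push a" "\<zero>\<^bsub>B.FG\<^esub>"] by auto
  also have "\<dots> \<longleftrightarrow> (\<forall>x\<in>carrier G. push a (h x) = \<zero>)"
    unfolding surj[symmetric] by blast
  also have "\<dots> \<longleftrightarrow> (\<forall>x\<in>carrier G. a (c \<otimes>\<^bsub>G\<^esub> x) = a x)"
  proof (intro ball_cong refl)
    fix x assume [simp]: "x \<in> carrier G"
    have "a x \<oplus> a (c \<otimes>\<^bsub>G\<^esub> x) = \<zero> \<longleftrightarrow> a (c \<otimes>\<^bsub>G\<^esub> x) = a x"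
      using A.add_self[of "a x"] A.F.add.l_cancel[of "a x" "a (c \<otimes>\<^bsub>G\<^esub> x)" "a x"] by auto
    then show "(push a (h x) = \<zero>) = (a (c \<otimes>\<^bsub>G\<^esub> x) = a x)" by (simp add: p)
  qed
  finally show ?thesis .
qed

section \<open>The kernel of the induced map\<close>

definition K where "K = {k \<in> carrier A.FG. push k = \<zero>\<^bsub>B.FG\<^esub>}"

lemma K_closed: "k \<in> K \<Longrightarrow> k \<in> carrier A.FG"
  by (simp add: K_def)

lemma K_invariant: "k \<in> K \<Longrightarrow> x \<in> carrier G \<Longrightarrow> k (c \<otimes>\<^bsub>G\<^esub> x) = k x"
  using push_eq_zero_iff[of k] unfolding K_def by blast

lemma K_I:
  "k \<in> carrier A.FG \<Longrightarrow> (\<And>x. x \<in> carrier G \<Longrightarrow> k (c \<otimes>\<^bsub>G\<^esub> x) = k x) \<Longrightarrow> k \<in> K"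
  using push_eq_zero_iff[of k] unfolding K_def by blast

lemma K_add: "k \<in> K \<Longrightarrow> l \<in> K \<Longrightarrow> k \<oplus>\<^bsub>A.FG\<^esub> l \<in> K"
  by (simp add: K_def push_add)

lemma K_star: "k \<in> K \<Longrightarrow> A.star k \<in> K"
  by (rule K_I) (auto simp: K_invariant K_closed)

text \<open>In the convolution, replacing y by cy changes neither factor, since \<open>k\<close> and
  \<open>l\<close> are invariant under \<open>c\<close> and \<open>c\<close> is its own inverse and
  central. The terms cancel in pairs.\<close>

lemma K_mult_zero:
  assumes k: "k \<in> K" and l: "l \<in> K"
  shows "k \<otimes>\<^bsub>A.FG\<^esub> l = \<zero>\<^bsub>A.FG\<^esub>"
proof (rule A.FG_eqI)
  note [simp] = K_closed[OF k] K_closed[OF l]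
  fix x assume [simp]: "x \<in> carrier G"
  have "(\<Oplus>y\<in>carrier G. k y \<otimes> l (inv\<^bsub>G\<^esub> y \<otimes>\<^bsub>G\<^esub> x)) = \<zero>"
    by (rule A.F.finsum_involution_cancel[where t = "\<lambda>y. c \<otimes>\<^bsub>G\<^esub> y"])
       (use k l A.finite_carrier c_ne in
         \<open>auto simp: K_invariant A.G.m_assoc A.add_self Pi_iff\<close>)
  then show "(k \<otimes>\<^bsub>A.FG\<^esub> l) x = \<zero>\<^bsub>A.FG\<^esub> x"
    by (simp add: A.FG_mult_apply)
qed (use k l K_closed in auto)

section \<open>Orbits under multiplication by c and inversion\<close>

definition orb where
  "orb x = {x, c \<otimes>\<^bsub>G\<^esub> x, inv\<^bsub>G\<^esub> x, c \<otimes>\<^bsub>G\<^esub> inv\<^bsub>G\<^esub> x}"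

lemma orb_c [simp]: "x \<in> carrier G \<Longrightarrow> orb (c \<otimes>\<^bsub>G\<^esub> x) = orb x"
  and orb_inv [simp]: "x \<in> carrier G \<Longrightarrow> orb (inv\<^bsub>G\<^esub> x) = orb x"
  by (auto simp: orb_def)

lemma orb_subset: "x \<in> carrier G \<Longrightarrow> orb x \<subseteq> carrier G"
  and orb_self: "x \<in> orb x"
  by (auto simp: orb_def)

lemma orb_eqI: "x \<in> carrier G \<Longrightarrow> y \<in> orb x \<Longrightarrow> orb y = orb x"
  using orb_c[of x] orb_inv[of x] orb_c[of "inv\<^bsub>G\<^esub> x"] unfolding orb_def[of x]
  by (auto simp: orb_def[of x])

lemma orb_disjoint:
  "x \<in> carrier G \<Longrightarrow> y \<in> carrier G \<Longrightarrow> orb x \<noteq> orb y \<Longrightarrow> orb x \<inter> orb y = {}"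
  using orb_eqI by blast

lemma square_trivial_eq: "square_trivial G = {x \<in> carrier G. inv\<^bsub>G\<^esub> x = x}"
proof -
  have "x [^]\<^bsub>G\<^esub> (2::nat) = \<one>\<^bsub>G\<^esub> \<longleftrightarrow> inv\<^bsub>G\<^esub> x = x" if "x \<in> carrier G" for x
    using that by (simp add: numeral_2_eq_2) (metis A.G.inv_equality A.G.r_inv)
  then show ?thesis by (auto simp: square_trivial_def)
qed

lemma card_orb:
  assumes [simp]: "x \<in> carrier G"
  shows "card (orb x) = (if x \<in> square_trivial G then 2 else 4)"
proof (cases "inv\<^bsub>G\<^esub> x = x")
  case True
  then have "orb x = {x, c \<otimes>\<^bsub>G\<^esub> x}" by (auto simp: orb_def)
  then show ?thesis using True c_ne by (simp add: square_trivial_eq card_insert_if)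
next
  case False
  moreover have "c \<otimes>\<^bsub>G\<^esub> x \<noteq> inv\<^bsub>G\<^esub> x"
    using ne_c_mult_inv[of "inv\<^bsub>G\<^esub> x"] by simp
  ultimately show ?thesis
    using ne_c_mult_inv[of x] c_ne
    by (simp add: orb_def square_trivial_eq card_insert_if eq_commute)
qed

lemma card_orbits_on:
  assumes M: "M \<subseteq> carrier G" and U: "\<Union> (orb ` M) = M"
    and k: "\<And>x. x \<in> M \<Longrightarrow> card (orb x) = k"
  shows "k * card (orb ` M) = card M"
proof -
  have fin: "finite M" using M A.finite_carrier finite_subset by blast
  have "k * card (orb ` M) = card (\<Union> (orb ` M))"
  proof (rule card_partition)
    fix P Q assume "P \<in> orb ` M" "Q \<in> orb ` M" "P \<noteq> Q"
    then show "P \<inter> Q = {}" using M orb_disjoint by blast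
  qed (use fin U k in auto)
  then show ?thesis using U by simp
qed

text \<open>With T = \<open>square_trivial G\<close>, there are |T|/2 orbits inside T and (|G| -
  |T|)/4 outside it; four times their total is |G| + |T|.\<close>

lemma card_orbits: "4 * card (orb ` carrier G) = order G + card (square_trivial G)"
proof -
  let ?T = "square_trivial G" and ?N = "carrier G - square_trivial G"
  have T: "?T \<subseteq> carrier G" by (auto simp: square_trivial_def)
  have finT: "finite ?T" using T A.finite_carrier finite_subset by blast
  \<comment> \<open>T is closed under multiplication by \<open>c\<close>, because inverting cx gives
    c x^-1.\<close>
  have inv_T: "orb x \<subseteq> ?T" if "x \<in> ?T" for x
    using that by (auto simp: orb_def square_trivial_eq)
  \<comment> \<open>An orbit that meets T is the orbit of a member of T and hence lies in T, so the
    complement is a union of orbits too.\<close>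
  have inv_N: "orb x \<subseteq> ?N" if x: "x \<in> ?N" for x
  proof
    fix y assume y: "y \<in> orb x"
    have "y \<notin> ?T"
    proof
      assume "y \<in> ?T"
      then have "orb y \<subseteq> ?T" by (rule inv_T)
      moreover have "x \<in> orb y" using orb_eqI[of x y] x y orb_self[of x] by auto
      ultimately show False using x by auto
    qed
    then show "y \<in> ?N" using y x orb_subset by auto
  qed
  have UT: "\<Union> (orb ` ?T) = ?T" using inv_T orb_self by blast
  have UN: "\<Union> (orb ` ?N) = ?N" using inv_N orb_self by blast
  have "2 * card (orb ` ?T) = card ?T"
    by (rule card_orbits_on[OF T UT]) (use T card_orb in auto)
  moreover have "4 * card (orb ` ?N) = card ?N"
    by (rule card_orbits_on[OF _ UN]) (use card_orb in auto)
  moreover have "card (orb ` carrier G) = card (orb ` ?T) + card (orb ` ?N)"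
  proof -
    have "orb ` carrier G = orb ` ?T \<union> orb ` ?N" using T by auto
    moreover have "orb ` ?T \<inter> orb ` ?N = {}"
      using inv_T inv_N orb_self by blast
    ultimately show ?thesis
      using finT A.finite_carrier by (simp add: card_Un_disjoint)
  qed
  moreover have "card ?N = order G - card ?T" "card ?T \<le> order G"
    using T finT A.finite_carrier by (auto simp: order_def card_Diff_subset card_mono)
  ultimately show ?thesis by linarith
qed

section \<open>Symmetric elements of the kernel\<close>

definition S where "S = {s \<in> K. A.star s = s}"

lemma S_orb:
  assumes "s \<in> S" "x \<in> carrier G" "y \<in> orb x"
  shows "s y = s x"
proof -
  have K: "s \<in> K" and "A.star s = s" using assms by (auto simp: S_def)
  then have i: "s (inv\<^bsub>G\<^esub> x) = s x" using A.star_apply[of x s] assms(2) by simp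
  then show ?thesis
    using assms(2,3) K by (auto simp: orb_def K_invariant)
qed

text \<open>Invariance under \<open>c\<close> and under inversion together mean being constant on
  orbits, so these elements correspond to arbitrary functions from the set of orbits to
  \<open>F\<close>.\<close>

lemma card_S: "card S = card (carrier F) ^ card (orb ` carrier G)"
proof -
  let ?E = "orb ` carrier G \<rightarrow>\<^sub>E carrier F"
  let ?f = "\<lambda>f. \<lambda>x\<in>carrier G. f (orb x)"
  have "bij_betw ?f ?E S"
  proof (rule bij_betw_imageI)
    show "inj_on ?f ?E"
    proof (rule inj_onI)
      fix f g assume fg: "f \<in> ?E" "g \<in> ?E" "?f f = ?f g"
      have "f (orb x) = g (orb x)" if "x \<in> carrier G" for x
        using fun_cong[OF fg(3), of x] that by simp
      then show "f = g" by (intro PiE_ext[OF fg(1,2)]) auto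
    qed
    show "?f ` ?E = S"
    proof (intro equalityI subsetI)
      fix s assume "s \<in> ?f ` ?E"
      then obtain f where f: "f \<in> ?E" "s = ?f f" by blast
      have s: "s \<in> carrier A.FG" using f by (auto simp: A.FG_carrier)
      have "s \<in> K" by (rule K_I[OF s]) (simp add: f(2))
      moreover have "A.star s = s"
        by (rule A.FG_eqI) (use s in \<open>auto simp: f(2)\<close>)
      ultimately show "s \<in> S" by (simp add: S_def)
    next
      fix s assume s: "s \<in> S"
      then have sc: "s \<in> carrier A.FG" by (simp add: S_def K_closed)
      \<comment> \<open>Any representative of the orbit gives the same value, by
        \<open>S_orb\<close>.\<close>
      let ?g = "\<lambda>P\<in>orb ` carrier G. s (SOME x. x \<in> P)"
      have sel: "(SOME y. y \<in> orb x) \<in> orb x" for x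
        using orb_self[of x] by (rule someI)
      have g: "?g (orb x) = s x" if "x \<in> carrier G" for x
        using that S_orb[OF s that sel] by simp
      have "?g \<in> ?E" using g sc by (auto simp: PiE_def extensional_def)
      moreover have "s = ?f ?g"
        by (rule A.FG_eqI) (use sc g in \<open>auto simp: A.FG_carrier\<close>)
      ultimately show "s \<in> ?f ` ?E" by blast
    qed
  qed
  then have "card S = card ?E" by (simp add: bij_betw_same_card)
  also have "\<dots> = card (carrier F) ^ card (orb ` carrier G)"
    using A.finite_carrier by (simp add: card_funcsetE)
  finally show ?thesis .
qed

text \<open>Where x is not its own inverse, the orbit of x falls into halves {r, cr} and their
  inverses. Restricting \<open>z\<close> to one half gives a \<open>j\<close> that is still
  invariant under \<open>c\<close>, and \<open>star j\<close> supplies the other half. At x = x^-1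
  the sum of \<open>j\<close> and \<open>star j\<close> is forced to vanish, hence the hypothesis
  \<open>zT\<close>.\<close>

lemma split_symmetric:
  assumes z: "z \<in> S" and zT: "\<And>x. x \<in> square_trivial G \<Longrightarrow> z x = \<zero>"
  obtains j where "j \<in> K" "j \<oplus>\<^bsub>A.FG\<^esub> A.star j = z"
proof -
  \<comment> \<open>The representative depends only on the orbit as a set, so x, cx and their
    inverses share it; \<open>P\<close> marks the half of the orbit containing it.\<close>
  define r where "r x = (SOME y. y \<in> orb x)" for x
  define P where "P x \<longleftrightarrow> x = r x \<or> x = c \<otimes>\<^bsub>G\<^esub> r x" for x
  define j where "j = (\<lambda>x\<in>carrier G. if P x then z x else \<zero>)"
  have zc [simp]: "z \<in> carrier A.FG" and zK: "z \<in> K" and zs: "A.star z = z"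
    using z by (auto simp: S_def K_closed)
  have zi: "z (inv\<^bsub>G\<^esub> x) = z x" if "x \<in> carrier G" for x
    using A.star_apply[OF that, of z] zs by simp
  have r: "r x \<in> orb x" for x unfolding r_def using orb_self[of x] by (rule someI)
  have rG [simp]: "r x \<in> carrier G" if "x \<in> carrier G" for x
    using r orb_subset that by blast
  have Pc: "P (c \<otimes>\<^bsub>G\<^esub> x) \<longleftrightarrow> P x" if x [simp]: "x \<in> carrier G" for x
  proof -
    have "r (c \<otimes>\<^bsub>G\<^esub> x) = r x" by (simp add: r_def)
    then show ?thesis unfolding P_def by (metis c_cancel rG x)
  qed
  have Pinv: "P (inv\<^bsub>G\<^esub> x) \<longleftrightarrow> \<not> P x" if x [simp]: "x \<in> carrier G" and ne: "inv\<^bsub>G\<^esub> x \<noteq> x" for x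
  proof -
    have ri: "r (inv\<^bsub>G\<^esub> x) = r x" by (simp add: r_def)
    \<comment> \<open>If c x^-1 were x, inversion would preserve the half {r, cr} instead of
      exchanging it with the other one.\<close>
    have n: "c \<otimes>\<^bsub>G\<^esub> inv\<^bsub>G\<^esub> x \<noteq> x" "c \<otimes>\<^bsub>G\<^esub> x \<noteq> inv\<^bsub>G\<^esub> x"
      using ne_c_mult_inv[of x] ne_c_mult_inv[of "inv\<^bsub>G\<^esub> x"] by auto
    have "r x = x \<or> r x = c \<otimes>\<^bsub>G\<^esub> x \<or> r x = inv\<^bsub>G\<^esub> x \<or> r x = c \<otimes>\<^bsub>G\<^esub> inv\<^bsub>G\<^esub> x"
      using r[of x] by (auto simp: orb_def)
    then show ?thesis
      unfolding P_def ri
      by (elim disjE) (use ne n ne[symmetric] n[symmetric] in simp_all)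
  qed
  have jc: "j \<in> carrier A.FG"
    using A.FG_apply[OF zc] by (auto simp: j_def A.FG_carrier)
  have "j \<in> K" by (rule K_I[OF jc]) (simp add: j_def Pc K_invariant[OF zK])
  moreover have "j \<oplus>\<^bsub>A.FG\<^esub> A.star j = z"
  proof (rule A.FG_eqI)
    fix x assume x [simp]: "x \<in> carrier G"
    show "(j \<oplus>\<^bsub>A.FG\<^esub> A.star j) x = z x"
    proof (cases "inv\<^bsub>G\<^esub> x = x")
      case True
      then have "z x = \<zero>" using zT by (simp add: square_trivial_eq)
      then show ?thesis using True by (simp add: j_def)
    next
      case False
      then show ?thesis by (simp add: j_def Pinv zi)
    qed
  qed (use jc in auto)
  ultimately show ?thesis by (rule that)
qed

section \<open>Lifting unitary units from the quotient\<close>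

lemma unitary_lift:
  assumes b: "b \<in> unitary_subgroup F H"
  obtains u where "u \<in> unitary_subgroup F G" "push u = b"
proof -
  have bc: "b \<in> carrier B.FG" and bb: "b \<otimes>\<^bsub>B.FG\<^esub> B.star b = \<one>\<^bsub>B.FG\<^esub>"
    using b by (auto simp: B.unitary_subgroup_eq)
  obtain u where u [simp]: "u \<in> carrier A.FG" and pu: "push u = b"
    using push_surj[OF bc] .
  \<comment> \<open>The defect of \<open>u\<close> from being unitary. Its image is
    \<open>1 + 1 = 0\<close> because \<open>b\<close> is unitary.\<close>
  define z where "z = u \<otimes>\<^bsub>A.FG\<^esub> A.star u \<oplus>\<^bsub>A.FG\<^esub> \<one>\<^bsub>A.FG\<^esub>"
  have zc [simp]: "z \<in> carrier A.FG" by (simp add: z_def)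
  have zK: "z \<in> K"
    by (simp add: K_def z_def push_add push_mult push_star push_one pu bb B.FG_add_self)
  have "A.star z = z"
    by (simp add: z_def A.star_add A.star_mult)
  then have zS: "z \<in> S" using zK by (simp add: S_def)
  have z_inv: "z x = \<zero>" if "x \<in> carrier G" "x \<otimes>\<^bsub>G\<^esub> x = \<one>\<^bsub>G\<^esub>" "x \<noteq> \<one>\<^bsub>G\<^esub>" for x
    using that by (simp add: z_def A.norm_coeff_involution)
  have "z x = \<zero>" if x: "x \<in> square_trivial G" for x
  proof (cases "x = \<one>\<^bsub>G\<^esub>")
    case True
    \<comment> \<open>The pairing argument fails at the identity, but invariance gives z(1) = z(c),
      and \<open>c\<close> is a nontrivial involution.\<close>
    then show ?thesis
      using K_invariant[OF zK, of "\<one>\<^bsub>G\<^esub>"] z_inv[of c] c_square c_ne by simp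
  next
    case False
    then show ?thesis using x by (intro z_inv) (auto simp: square_trivial_def numeral_2_eq_2)
  qed
  then obtain j where j: "j \<in> K" and jz: "j \<oplus>\<^bsub>A.FG\<^esub> A.star j = z"
    using split_symmetric[OF zS] by blast
  let ?p = "\<one>\<^bsub>A.FG\<^esub> \<oplus>\<^bsub>A.FG\<^esub> j"
  define v where "v = ?p \<otimes>\<^bsub>A.FG\<^esub> u"
  note [simp] = K_closed[OF j]
  have uu: "u \<otimes>\<^bsub>A.FG\<^esub> A.star u = \<one>\<^bsub>A.FG\<^esub> \<oplus>\<^bsub>A.FG\<^esub> z"
  proof -
    have "\<one>\<^bsub>A.FG\<^esub> \<oplus>\<^bsub>A.FG\<^esub> z =
        u \<otimes>\<^bsub>A.FG\<^esub> A.star u \<oplus>\<^bsub>A.FG\<^esub> (\<one>\<^bsub>A.FG\<^esub> \<oplus>\<^bsub>A.FG\<^esub> \<one>\<^bsub>A.FG\<^esub>)"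
      by (simp add: z_def A.FG.a_ac del: A.FG.r_zero)
    then show ?thesis by (simp add: A.FG_add_self)
  qed
  have "v \<otimes>\<^bsub>A.FG\<^esub> A.star v = ?p \<otimes>\<^bsub>A.FG\<^esub> (u \<otimes>\<^bsub>A.FG\<^esub> A.star u) \<otimes>\<^bsub>A.FG\<^esub> A.star ?p"
    by (simp add: v_def A.star_mult A.FG.m_assoc)
  also have "?p \<otimes>\<^bsub>A.FG\<^esub> (u \<otimes>\<^bsub>A.FG\<^esub> A.star u) = \<one>\<^bsub>A.FG\<^esub> \<oplus>\<^bsub>A.FG\<^esub> (j \<oplus>\<^bsub>A.FG\<^esub> z)"
    using K_mult_zero[OF j zK]
    by (simp add: uu A.FG.l_distr A.FG.r_distr A.FG.a_ac)
  also have "\<dots> \<otimes>\<^bsub>A.FG\<^esub> A.star ?p =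
      \<one>\<^bsub>A.FG\<^esub> \<oplus>\<^bsub>A.FG\<^esub> (z \<oplus>\<^bsub>A.FG\<^esub> (j \<oplus>\<^bsub>A.FG\<^esub> A.star j))"
    using K_mult_zero[OF K_add[OF j zK] K_star[OF j]]
    by (simp add: A.star_add A.FG.l_distr A.FG.r_distr A.FG.a_ac)
  also have "\<dots> = \<one>\<^bsub>A.FG\<^esub>"
    by (simp add: jz A.FG_add_self)
  finally have "v \<in> unitary_subgroup F G"
    by (simp add: A.unitary_subgroup_eq v_def)
  moreover have "push v = b"
    using j bc by (simp add: v_def push_mult push_add push_one pu K_def)
  ultimately show ?thesis by (rule that)
qed

section \<open>Counting unitary units through the quotient map\<close>

lemma unitary_mult:
  assumes "u \<in> unitary_subgroup F G" "v \<in> unitary_subgroup F G"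
  shows "u \<otimes>\<^bsub>A.FG\<^esub> v \<in> unitary_subgroup F G"
proof -
  have [simp]: "u \<in> carrier A.FG" "v \<in> carrier A.FG"
    and uv: "u \<otimes>\<^bsub>A.FG\<^esub> A.star u = \<one>\<^bsub>A.FG\<^esub>" "v \<otimes>\<^bsub>A.FG\<^esub> A.star v = \<one>\<^bsub>A.FG\<^esub>"
    using assms by (auto simp: A.unitary_subgroup_eq)
  have "(u \<otimes>\<^bsub>A.FG\<^esub> v) \<otimes>\<^bsub>A.FG\<^esub> A.star (u \<otimes>\<^bsub>A.FG\<^esub> v) =
      u \<otimes>\<^bsub>A.FG\<^esub> (v \<otimes>\<^bsub>A.FG\<^esub> A.star v) \<otimes>\<^bsub>A.FG\<^esub> A.star u"
    by (simp add: A.star_mult A.FG.m_assoc)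
  then show ?thesis by (simp add: uv A.unitary_subgroup_eq)
qed

text \<open>Since s s* = 0, the norm of 1 + s is 1 + s* + s, so unitarity reduces to a linear
  condition.\<close>

lemma one_plus_K_unitary_iff:
  assumes s: "s \<in> K"
  shows "\<one>\<^bsub>A.FG\<^esub> \<oplus>\<^bsub>A.FG\<^esub> s \<in> unitary_subgroup F G \<longleftrightarrow> s \<in> S"
proof -
  note [simp] = K_closed[OF s]
  have eq: "(\<one>\<^bsub>A.FG\<^esub> \<oplus>\<^bsub>A.FG\<^esub> s) \<otimes>\<^bsub>A.FG\<^esub> A.star (\<one>\<^bsub>A.FG\<^esub> \<oplus>\<^bsub>A.FG\<^esub> s) =
      \<one>\<^bsub>A.FG\<^esub> \<oplus>\<^bsub>A.FG\<^esub> (A.star s \<oplus>\<^bsub>A.FG\<^esub> s)"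
    using K_mult_zero[OF s K_star[OF s]]
    by (simp add: A.star_add A.FG.l_distr A.FG.r_distr A.FG.a_ac)
  have "A.star s \<oplus>\<^bsub>A.FG\<^esub> s = \<zero>\<^bsub>A.FG\<^esub> \<longleftrightarrow> A.star s = s"
    by (rule A.FG_eq_iff_add_zero) auto
  then show ?thesis
    using s by (simp add: A.unitary_subgroup_eq S_def eq)
qed

lemma unitary_star:
  assumes "u \<in> unitary_subgroup F G"
  shows "A.star u \<in> unitary_subgroup F G" "A.star u \<otimes>\<^bsub>A.FG\<^esub> u = \<one>\<^bsub>A.FG\<^esub>"
  using assms A.right_inverse_is_left_inverse[of u "A.star u"]
  by (auto simp: A.unitary_subgroup_eq)

text \<open>A set-theoretic section \<open>l\<close> of the surjection on unitary units gives the
  bijection (s, b) -> (1 + s) l(b); all fibres thus have the size of \<open>S\<close>, with no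
  quotient group needed.\<close>

lemma card_unitary:
  "card (unitary_subgroup F G) = card S * card (unitary_subgroup F H)"
proof -
  let ?V = "unitary_subgroup F G" and ?W = "unitary_subgroup F H"
  obtain l where l: "\<And>b. b \<in> ?W \<Longrightarrow> l b \<in> ?V \<and> push (l b) = b"
  proof -
    have "\<forall>b\<in>?W. \<exists>u. u \<in> ?V \<and> push u = b" using unitary_lift by blast
    then show ?thesis using that by (auto dest!: bchoice)
  qed
  have V: "u \<in> carrier A.FG" "u \<otimes>\<^bsub>A.FG\<^esub> A.star u = \<one>\<^bsub>A.FG\<^esub>" if "u \<in> ?V" for u
    using that by (auto simp: A.unitary_subgroup_eq)
  let ?f = "\<lambda>(s, b). (\<one>\<^bsub>A.FG\<^esub> \<oplus>\<^bsub>A.FG\<^esub> s) \<otimes>\<^bsub>A.FG\<^esub> l b"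
  have pf: "push (?f (s, b)) = b" if "s \<in> S" "b \<in> ?W" for s b
    using that l[OF that(2)] V(1)[of "l b"]
    by (auto simp: push_mult push_add push_one S_def K_def B.unitary_subgroup_eq)
  have "bij_betw ?f (S \<times> ?W) ?V"
  proof (rule bij_betw_imageI)
    show "inj_on ?f (S \<times> ?W)"
    proof (rule inj_onI, clarify)
      fix s b s' b'
      assume s: "s \<in> S" "s' \<in> S" and b: "b \<in> ?W" "b' \<in> ?W"
        and eq: "(\<one>\<^bsub>A.FG\<^esub> \<oplus>\<^bsub>A.FG\<^esub> s) \<otimes>\<^bsub>A.FG\<^esub> l b = (\<one>\<^bsub>A.FG\<^esub> \<oplus>\<^bsub>A.FG\<^esub> s') \<otimes>\<^bsub>A.FG\<^esub> l b'"
      have bb: "b = b'" using pf[OF s(1) b(1)] pf[OF s(2) b(2)] eq by simp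
      have [simp]: "s \<in> carrier A.FG" "s' \<in> carrier A.FG" using s by (auto simp: S_def K_closed)
      have lc [simp]: "l b \<in> carrier A.FG" and lu: "l b \<otimes>\<^bsub>A.FG\<^esub> A.star (l b) = \<one>\<^bsub>A.FG\<^esub>"
        using l[OF b(1)] V by auto
      \<comment> \<open>Once \<open>b = b'\<close>, the common factor \<open>l b\<close> is
        cancelled on the right by its inverse \<open>star (l b)\<close>.\<close>
      have "(\<one>\<^bsub>A.FG\<^esub> \<oplus>\<^bsub>A.FG\<^esub> t) \<otimes>\<^bsub>A.FG\<^esub> l b \<otimes>\<^bsub>A.FG\<^esub> A.star (l b) = \<one>\<^bsub>A.FG\<^esub> \<oplus>\<^bsub>A.FG\<^esub> t"
        if "t \<in> carrier A.FG" for t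
        using that by (simp add: A.FG.m_assoc lu)
      then have "\<one>\<^bsub>A.FG\<^esub> \<oplus>\<^bsub>A.FG\<^esub> s = \<one>\<^bsub>A.FG\<^esub> \<oplus>\<^bsub>A.FG\<^esub> s'"
        using eq bb by (metis \<open>s \<in> carrier A.FG\<close> \<open>s' \<in> carrier A.FG\<close>)
      then show "s = s' \<and> b = b'"
        using bb A.FG.add.l_cancel[of "\<one>\<^bsub>A.FG\<^esub>" s s'] by simp
    qed
    show "?f ` (S \<times> ?W) = ?V"
    proof (intro equalityI subsetI)
      fix u assume "u \<in> ?f ` (S \<times> ?W)"
      then obtain s b where sb: "s \<in> S" "b \<in> ?W" "u = (\<one>\<^bsub>A.FG\<^esub> \<oplus>\<^bsub>A.FG\<^esub> s) \<otimes>\<^bsub>A.FG\<^esub> l b"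
        by auto
      then show "u \<in> ?V"
        using l[OF sb(2)] one_plus_K_unitary_iff[of s] by (auto simp: S_def intro: unitary_mult)
    next
      fix u assume u: "u \<in> ?V"
      note [simp] = V(1)[OF u]
      have "push u \<in> ?W"
        using V(2)[OF u, THEN arg_cong[of _ _ push]]
        by (simp add: B.unitary_subgroup_eq push_mult push_star push_one)
      then have lV: "l (push u) \<in> ?V" and pl: "push (l (push u)) = push u" using l by auto
      note [simp] = V(1)[OF lV]
      \<comment> \<open>The quotient of \<open>u\<close> by the chosen lift of its image. It is
        unitary and maps to \<open>1\<close>, so it has the form 1 + s with \<open>s\<close> in
        \<open>S\<close>.\<close>
      define w where "w = u \<otimes>\<^bsub>A.FG\<^esub> A.star (l (push u))"
      define s where "s = \<one>\<^bsub>A.FG\<^esub> \<oplus>\<^bsub>A.FG\<^esub> w"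
      have wV: "w \<in> ?V"
        unfolding w_def by (rule unitary_mult[OF u unitary_star(1)[OF lV]])
      have [simp]: "w \<in> carrier A.FG" by (simp add: w_def)
      have "push w = \<one>\<^bsub>B.FG\<^esub>"
        using V(2)[OF u, THEN arg_cong[of _ _ push]]
        by (simp add: w_def push_mult push_star push_one pl)
      then have sK: "s \<in> K"
        by (simp add: K_def s_def push_add push_one B.FG_add_self)
      have w: "\<one>\<^bsub>A.FG\<^esub> \<oplus>\<^bsub>A.FG\<^esub> s = w"
        by (simp add: s_def A.FG.a_assoc[symmetric] A.FG_add_self)
      then have "s \<in> S" using one_plus_K_unitary_iff[OF sK] wV by simp
      moreover have "w \<otimes>\<^bsub>A.FG\<^esub> l (push u) = u"
        by (simp add: w_def A.FG.m_assoc unitary_star(2)[OF lV])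
      ultimately show "u \<in> ?f ` (S \<times> ?W)"
        using \<open>push u \<in> ?W\<close> w by (auto intro!: image_eqI[where x = "(s, push u)"])
    qed
  qed
  then show ?thesis by (simp add: bij_betw_same_card[symmetric] card_cartesian_product)
qed

text \<open>The real exponent is the number of orbits, so \<open>powr\<close> is an ordinary power;
  the conversion requires the base to be positive.\<close>

lemma card_unitary_powr:
  "real (card (unitary_subgroup F G)) =
     real (card (carrier F)) powr (real (order G + card (square_trivial G)) / 4)
       * real (card (unitary_subgroup F H))"
proof -
  have pos: "card (carrier F) > 0"
    using A.finite_F A.F.one_closed by (auto simp: card_gt_0_iff)
  have "real (order G + card (square_trivial G)) / 4 = real (card (orb ` carrier G))"
    unfolding card_orbits[symmetric] by simp
  with pos show ?thesis
    by (simp only: card_unitary card_S powr_realpow of_nat_mult of_nat_power of_nat_0_less_iff)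
qed

end

section \<open>Central involutions and the passage to G/C\<close>

lemma center_2D:
  assumes "group G" and z: "z \<in> center_2 G"
  shows "z \<in> group_center G" and "z \<otimes>\<^bsub>G\<^esub> z = \<one>\<^bsub>G\<^esub>"
proof -
  interpret G: group G by fact
  let ?Z = "{z \<in> group_center G. G.ord z = 2}"
  have base: "u \<in> group_center G \<and> u \<otimes>\<^bsub>G\<^esub> u = \<one>\<^bsub>G\<^esub>" if u: "u \<in> ?Z" for u
  proof -
    have [simp]: "u \<in> carrier G" and "G.ord u = 2"
      using u by (auto simp: group_center_def)
    then have "u [^]\<^bsub>G\<^esub> (2::nat) = \<one>\<^bsub>G\<^esub>" by (metis G.pow_ord_eq_1)
    then show ?thesis using u by (simp add: numeral_2_eq_2)
  qed
  from z have "z \<in> group_center G \<and> z \<otimes>\<^bsub>G\<^esub> z = \<one>\<^bsub>G\<^esub>"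
    unfolding center_2_def
  proof (induction rule: generate.induct)
    case one
    then show ?case by (auto simp: group_center_def)
  next
    case (incl u)
    then show ?case by (rule base)
  next
    case (inv u)
    from base[OF inv] have u: "u \<in> group_center G \<and> u \<otimes>\<^bsub>G\<^esub> u = \<one>\<^bsub>G\<^esub>" .
    then have "inv\<^bsub>G\<^esub> u = u" by (auto simp: group_center_def intro: G.inv_equality)
    with u show ?case by simp
  next
    case (eng u v)
    then have [simp]: "u \<in> carrier G" "v \<in> carrier G"
      and uc: "\<And>g. g \<in> carrier G \<Longrightarrow> u \<otimes>\<^bsub>G\<^esub> g = g \<otimes>\<^bsub>G\<^esub> u"
      and vc: "\<And>g. g \<in> carrier G \<Longrightarrow> v \<otimes>\<^bsub>G\<^esub> g = g \<otimes>\<^bsub>G\<^esub> v"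
      and uu: "u \<otimes>\<^bsub>G\<^esub> u = \<one>\<^bsub>G\<^esub>" and vv: "v \<otimes>\<^bsub>G\<^esub> v = \<one>\<^bsub>G\<^esub>"
      by (auto simp: group_center_def)
    have comm: "(u \<otimes>\<^bsub>G\<^esub> v) \<otimes>\<^bsub>G\<^esub> g = g \<otimes>\<^bsub>G\<^esub> (u \<otimes>\<^bsub>G\<^esub> v)" if [simp]: "g \<in> carrier G" for g
    proof -
      have "(u \<otimes>\<^bsub>G\<^esub> v) \<otimes>\<^bsub>G\<^esub> g = u \<otimes>\<^bsub>G\<^esub> (g \<otimes>\<^bsub>G\<^esub> v)"
        using vc[of g] by (simp add: G.m_assoc)
      also have "\<dots> = g \<otimes>\<^bsub>G\<^esub> (u \<otimes>\<^bsub>G\<^esub> v)"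
        using uc[of g] by (simp add: G.m_assoc[symmetric])
      finally show ?thesis .
    qed
    have "(u \<otimes>\<^bsub>G\<^esub> v) \<otimes>\<^bsub>G\<^esub> (u \<otimes>\<^bsub>G\<^esub> v) = u \<otimes>\<^bsub>G\<^esub> (u \<otimes>\<^bsub>G\<^esub> (v \<otimes>\<^bsub>G\<^esub> v))"
      using vc[of "u \<otimes>\<^bsub>G\<^esub> v"] by (simp add: G.m_assoc)
    then have "(u \<otimes>\<^bsub>G\<^esub> v) \<otimes>\<^bsub>G\<^esub> (u \<otimes>\<^bsub>G\<^esub> v) = \<one>\<^bsub>G\<^esub>"
      by (simp add: uu vv)
    moreover have "u \<otimes>\<^bsub>G\<^esub> v \<in> carrier G" by simp
    ultimately show ?case using comm unfolding group_center_def by blast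
  qed
  then show "z \<in> group_center G" and "z \<otimes>\<^bsub>G\<^esub> z = \<one>\<^bsub>G\<^esub>" by auto
qed

lemma (in group) generate_central_involution:
  assumes "c \<in> group_center G" and cc: "c \<otimes> c = \<one>"
  shows "generate G {c} = {\<one>, c}" and "generate G {c} \<lhd> G"
proof -
  have c [simp]: "c \<in> carrier G" and comm: "\<And>g. g \<in> carrier G \<Longrightarrow> c \<otimes> g = g \<otimes> c"
    using assms(1) unfolding group_center_def by blast+
  have ic: "inv c = c" using cc by (simp add: inv_equality)
  have "x \<in> {\<one>, c}" if "x \<in> generate G {c}" for x
    using that by (induction rule: generate.induct) (use cc ic in auto)
  then show eq: "generate G {c} = {\<one>, c}"
    by (auto intro: generate.one generate.incl)
  show "generate G {c} \<lhd> G"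
    unfolding normal_inv_iff
  proof (intro conjI ballI)
    show "subgroup (generate G {c}) G" by (rule generate_is_subgroup) simp
    fix x y assume x: "x \<in> carrier G" and "y \<in> generate G {c}"
    then have "y = \<one> \<or> y = c" using eq by auto
    moreover have "x \<otimes> c \<otimes> inv x = c"
      unfolding comm[OF x, symmetric] using x by (simp add: m_assoc)
    ultimately have "x \<otimes> y \<otimes> inv x = y" using x by auto
    then show "x \<otimes> y \<otimes> inv x \<in> generate G {c}"
      using \<open>y \<in> generate G {c}\<close> by simp
  qed
qed

lemma (in normal) kernel_r_coset: "kernel G (G Mod H) (\<lambda>a. H #> a) = H"
  unfolding kernel_def one_FactGroup
  using coset_join1[OF _ _ subgroup_axioms] coset_join2[OF _ subgroup_axioms] subset by blast

theorem theorem1: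
  fixes F :: "('f, 'n) ring_scheme"
    and G :: "('g, 'm) monoid_scheme"
    and c :: 'g and C :: "'g set"
  assumes "field F" and "finite (carrier F)" and "ring_characteristic F = 2"
    and "finite_p_group 2 G"
    and "c \<in> center_2 G - squares G"
    and "C = generate G {c}"
    and "in_Theta (G Mod C)"
  shows "real (card (unitary_subgroup F G)) =
           real (card (carrier F)) powr (real (order G + card (square_trivial G)) / 4)
             * real (card (unitary_subgroup F (G Mod C)))"
proof -
  interpret F: field F by fact
  interpret G: group G using assms(4) by (simp add: finite_p_group_def)
  have fin: "finite (carrier G)" using assms(4) by (simp add: finite_p_group_def)
  have c: "c \<in> group_center G" "c \<otimes>\<^bsub>G\<^esub> c = \<one>\<^bsub>G\<^esub>"
    using center_2D[OF G.group_axioms] assms(5) by auto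
  have C: "C = {\<one>\<^bsub>G\<^esub>, c}" and "C \<lhd> G"
    using G.generate_central_involution[OF c] assms(6) by auto
  then interpret C: normal C G by simp
  interpret Q: group "G Mod C" by (rule C.factorgroup_is_group)
  have two: "\<one>\<^bsub>F\<^esub> \<oplus>\<^bsub>F\<^esub> \<one>\<^bsub>F\<^esub> = \<zero>\<^bsub>F\<^esub>"
  proof -
    let ?P = "\<lambda>n::nat. 0 < n \<and> [n] \<cdot>\<^bsub>F\<^esub> \<one>\<^bsub>F\<^esub> = \<zero>\<^bsub>F\<^esub>"
    \<comment> \<open>The value 2 rules out the default branch 0, so the least annihilating positive
      integer exists and equals 2.\<close>
    have "\<exists>n. ?P n" "(LEAST n. ?P n) = 2"
      using assms(3) by (auto simp: ring_characteristic_def split: if_splits)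
    then have "?P 2" using LeastI_ex[of ?P] by simp
    then show ?thesis by (simp add: numeral_2_eq_2)
  qed
  \<comment> \<open>\<open>center_2 G\<close> contains the identity, so this must come from
    elsewhere: the identity is a square and \<open>c\<close> is not.\<close>
  have "c \<noteq> \<one>\<^bsub>G\<^esub>"
  proof
    assume "c = \<one>\<^bsub>G\<^esub>"
    then have "c = \<one>\<^bsub>G\<^esub> [^]\<^bsub>G\<^esub> (2::nat)" by simp
    then have "c \<in> squares G" unfolding squares_def by blast
    then show False using assms(5) by blast
  qed
  \<comment> \<open>The covering map is the projection onto cosets of \<open>C\<close>; its kernel
    is \<open>C\<close>, the set of the identity and \<open>c\<close>.\<close>
  then interpret char2_double_cover F G "G Mod C" "\<lambda>a. C #>\<^bsub>G\<^esub> a" c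
    using fin two assms(2,5) C.r_coset_hom_Mod C.kernel_r_coset C
    by unfold_locales (auto simp: carrier_FactGroup)
  show ?thesis by (rule card_unitary_powr)
qed

end
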